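(* For any integers $r\ge d\ge 3$ we have $$ \gamma_r(d) < K_d\cdot 2^{\left(\frac12-\varepsilon_d\right) r}, $$ where $\varepsilon_d=\frac1{2(2^d-1)}$ and $K_d=(2^d-1)\,2^{2^{d-1}-(3/2)+\varepsilon_d}$.
   Context: Let $\mathbb{F}_2^r$ be the $r$-dimensional vector space over the two-element field, and let $0\le d\le r$ be an integer. A subset $C\subseteq\mathbb{F}_2^r$ is called $d$-complete if for every $v\in\mathbb{F}_2^r$ there exists a linear subspace $L_v\le\mathbb{F}_2^r$ of dimension $d$ such that $v+(L_v\setminus\{0\})\subseteq C$. By $\gamma_r(d)$ we denote the smallest possible size of a $d$-complete subset of $\mathbb{F}_2^r$. *)

theory Defs
  imports "HOL-Analysis.Cartesian_Space" "HOL-Library.Z2" "HOL-Library.Cardinality"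
begin

text \<open>
  The space of dimension \<open>r\<close> over the two-element field is \<open>bit ^ 'r\<close> with \<open>CARD('r) = r\<close>.
  The predicates \<open>vec.subspace\<close> and \<open>vec.dim\<close> refer to the scalar multiplication \<open>*s\<close>
  by elements of \<open>bit\<close>.
\<close>

definition d_complete :: "nat \<Rightarrow> (bit ^ 'r::finite) set \<Rightarrow> bool" where
  "d_complete d C \<longleftrightarrow>
     (\<forall>v. \<exists>L. vec.subspace L \<and> vec.dim L = d \<and> (\<lambda>x. v + x) ` (L - {0}) \<subseteq> C)"

text \<open>
  The type argument carries the dimension \<open>CARD('r)\<close>. For \<open>d \<le> CARD('r)\<close> the minimum exists,
  see \<open>d_complete_UNIV\<close>; for larger \<open>d\<close> there is no complete set and the value is unspecified.
\<close>

definition gamma :: "'r::finite itself \<Rightarrow> nat \<Rightarrow> nat" where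
  "gamma (_ :: 'r itself) d = (LEAST n. \<exists>C :: (bit ^ 'r) set. d_complete d C \<and> card C = n)"

lemma d_complete_UNIV:
  assumes "d \<le> CARD('r::finite)"
  shows "d_complete d (UNIV :: (bit ^ 'r) set)"
proof -
  obtain B :: "(bit ^ 'r) set" where B: "B \<subseteq> cart_basis" "card B = d"
    using assms obtain_subset_with_card_n[of d "cart_basis :: (bit ^ 'r) set"]
    by (metis card_cart_basis)
  have "vec.dim (vec.span B) = d"
    using vec.dim_span_eq_card_independent vec.independent_mono[OF independent_cart_basis] B
    by blast
  moreover have "vec.subspace (vec.span B)"
    by simp
  ultimately show ?thesis
    unfolding d_complete_def by blast
qed

lemma gamma_attained:
  assumes "d \<le> CARD('r::finite)"
  shows "\<exists>C :: (bit ^ 'r) set. d_complete d C \<and> card C = gamma TYPE('r) d"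
  unfolding gamma_def
  by (rule LeastI_ex) (use d_complete_UNIV[OF assms] in blast)

lemma gamma_le:
  fixes C :: "(bit ^ 'r::finite) set"
  assumes "d_complete d C"
  shows "gamma TYPE('r) d \<le> card C"
  unfolding gamma_def by (rule Least_le) (use assms in blast)

definition eps :: "nat \<Rightarrow> real" where
  "eps d = 1 / (2 * (2 ^ d - 1))"

definition K :: "nat \<Rightarrow> real" where
  "K d = (2 ^ d - 1) * 2 powr (2 ^ (d - 1) - 3 / 2 + eps d)"

end

theory Submission
  imports Defs
begin

text \<open>
  Let \<open>n = 2 ^ d - 1\<close>. For \<open>r < n\<close> the whole space is small enough. Otherwise distribute the
  coordinates evenly over \<open>n\<close> blocks labelled by the points of the projective space
  \<open>PG(d - 1, 2)\<close>, and let \<open>C\<close> be the union, over the \<open>n\<close> hyperplanes, of the spaces of vectors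
  supported on the blocks in that hyperplane. For a linear form \<open>f\<close> write \<open>l f\<close> for the vector
  with blocks \<open>f p \<cdot> v p\<close>. Then \<open>v + l f\<close> is supported on \<open>ker f\<close>, so the space of all \<open>l f\<close>
  serves as \<open>L\<^sub>v\<close> if \<open>l\<close> is injective. If \<open>l f = 0\<close> for some \<open>f \<noteq> 0\<close>, then \<open>v\<close> itself lies in
  the part of \<open>C\<close> for \<open>ker f\<close>, which is a linear space of dimension at least
  \<open>2 ^ (d - 1) - 1 \<ge> d\<close>; this last inequality is where \<open>d \<ge> 3\<close> enters.
\<close>

section \<open>Vectors supported on a set of coordinates\<close>

definition supported_on :: "'r set \<Rightarrow> (bit ^ 'r::finite) set" where
  "supported_on J = {x. \<forall>j. j \<notin> J \<longrightarrow> x $ j = 0}"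

lemma subspace_supported_on: "vec.subspace (supported_on J)"
  by (auto simp: vec.subspace_def supported_on_def)

lemma
  fixes J :: "'r::finite set"
  shows finite_supported_on: "finite (supported_on J)"
    and card_supported_on_le: "card (supported_on J) \<le> 2 ^ card J"
proof -
  have "inj_on (\<lambda>x :: bit ^ 'r. {j. x $ j = 1}) (supported_on J)"
  proof (rule inj_onI)
    fix x y :: "bit ^ 'r"
    assume "{j. x $ j = 1} = {j. y $ j = 1}"
    then have "x $ j = 1 \<longleftrightarrow> y $ j = 1" for j
      by blast
    then have "x $ j = y $ j" for j
      by (metis bit_not_one_iff)
    then show "x = y"
      by (simp add: vec_eq_iff)
  qed
  moreover have "(\<lambda>x. {j. x $ j = 1}) ` supported_on J \<subseteq> Pow J"
    by (auto simp: supported_on_def)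
  ultimately show "finite (supported_on J)"
    and "card (supported_on J) \<le> 2 ^ card J"
    using inj_on_finite card_inj_on_le[of _ "supported_on J" "Pow J"]
    by (fastforce simp: card_Pow)+
qed

text \<open>Spanned by \<open>d\<close> of the unit vectors of \<open>J\<close>; it supplies
  \<open>L\<close> when \<open>v\<close> already lies in the union.\<close>

lemma subspace_of_dim_supported_on:
  fixes J :: "'r::finite set"
  assumes "d \<le> card J"
  obtains L where "vec.subspace L" "vec.dim L = d" "L \<subseteq> supported_on J"
proof -
  obtain J' where J': "J' \<subseteq> J" "card J' = d"
    using assms obtain_subset_with_card_n by metis
  define B where "B = (\<lambda>j. axis j (1::bit)) ` J'"
  have "card B = d"
    unfolding B_def using J' by (subst card_image) (auto simp: inj_on_def axis_eq_axis)
  moreover have "B \<subseteq> cart_basis"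
    by (auto simp: B_def cart_basis_def)
  ultimately have "vec.dim (vec.span B) = d"
    using vec.dim_span_eq_card_independent vec.independent_mono[OF independent_cart_basis] by blast
  moreover have "vec.span B \<subseteq> supported_on J"
    using J' by (intro vec.span_minimal subspace_supported_on)
      (auto simp: B_def supported_on_def axis_def)
  ultimately show ?thesis
    using that vec.subspace_span by blast
qed

section \<open>Counting the points of a hyperplane\<close>

text \<open>Toggling a fixed \<open>s \<in> S\<close> in \<open>P\<close> reverses the parity of the
  intersection, so it pairs the even subsets with the odd ones.\<close>

lemma card_even_inter:
  assumes "finite A" "S \<subseteq> A" "S \<noteq> {}"
  shows "card {P \<in> Pow A. even (card (S \<inter> P))} = 2 ^ (card A - 1)"
proof -
  obtain s where s: "s \<in> S"
    using assms by blast
  define flip where "flip P = (if s \<in> P then P - {s} else insert s P)" for P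
  let ?E = "{P \<in> Pow A. even (card (S \<inter> P))}"
  let ?O = "{P \<in> Pow A. odd (card (S \<inter> P))}"
  have fin: "finite (S \<inter> P)" for P
    using assms finite_subset by blast
  have parity: "even (card (S \<inter> flip P)) \<longleftrightarrow> odd (card (S \<inter> P))" for P
  proof (cases "s \<in> P")
    case True
    then have "S \<inter> P = insert s (S \<inter> flip P)" "s \<notin> S \<inter> flip P"
      using s by (auto simp: flip_def)
    then show ?thesis
      using fin[of "flip P"] by simp
  next
    case False
    then have "S \<inter> flip P = insert s (S \<inter> P)" "s \<notin> S \<inter> P"
      using s by (auto simp: flip_def)
    then show ?thesis
      using fin[of P] by simp
  qed
  have "flip (flip P) = P" "P \<subseteq> A \<Longrightarrow> flip P \<subseteq> A" for P
    using s assms by (auto simp: flip_def)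
  then have "bij_betw flip ?E ?O"
    by (intro bij_betwI[of _ _ _ flip]) (simp_all add: parity)
  then have "card ?E = card ?O"
    by (rule bij_betw_same_card)
  moreover have "card (Pow A) = card (?E \<union> ?O)"
    by (rule arg_cong[where f = card]) blast
  moreover have "card (?E \<union> ?O) = card ?E + card ?O"
    using assms(1) by (intro card_Un_disjoint) auto
  ultimately have "2 ^ card A = 2 * card ?E"
    using assms(1) by (simp add: card_Pow)
  moreover have "card A > 0"
    using assms s by (auto simp: card_gt_0_iff)
  ultimately show ?thesis
    by (cases "card A") simp_all
qed

text \<open>This counts the points of a hyperplane: the empty set meets \<open>S\<close> evenly but
  is not a point, hence the 1 subtracted.\<close>

lemma card_nonempty_even_inter:
  assumes "S \<subseteq> {..<d}" "S \<noteq> {}"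
  shows "card {P \<in> Pow {..<d} - {{}}. even (card (S \<inter> P))} = 2 ^ (d - 1) - 1"
proof -
  have "{P \<in> Pow {..<d} - {{}}. even (card (S \<inter> P))} =
      {P \<in> Pow {..<d}. even (card (S \<inter> P))} - {{}}"
    by auto
  then show ?thesis
    using card_even_inter[OF _ assms] by (simp add: card_Diff_singleton)
qed

section \<open>Distributing the coordinates over the points\<close>

text \<open>Number the coordinates from 0 and deal them out cyclically by residue modulo
  \<open>card Q\<close>. The bound is the ceiling of \<open>CARD('r) / card Q\<close>.\<close>

lemma even_distribution:
  fixes Q :: "'a set"
  assumes "finite Q" "Q \<noteq> {}" "card Q \<le> CARD('r::finite)"
  obtains p :: "'r::finite \<Rightarrow> 'a" where "range p = Q"
    "\<And>q. card (p -` {q}) \<le> (CARD('r) - 1) div card Q + 1"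
proof -
  define n where "n = card Q"
  have n: "n > 0" "n \<le> CARD('r)"
    using assms by (auto simp: n_def card_gt_0_iff)
  obtain e where e: "bij_betw e (UNIV :: 'r set) {0..<CARD('r)}"
    using ex_bij_betw_finite_nat[of "UNIV :: 'r set"] by auto
  obtain g where g: "bij_betw g {0..<n} Q"
    using ex_bij_betw_nat_finite[OF assms(1)] n_def by blast
  define p where "p j = g (e j mod n)" for j
  have e_lt: "e j < CARD('r)" for j
    using e by (auto simp: bij_betw_def)
  have "range p = Q"
  proof
    show "range p \<subseteq> Q"
      using g n by (auto simp: p_def bij_betw_def)
    show "Q \<subseteq> range p"
    proof
      fix q assume "q \<in> Q"
      then obtain t where t: "t < n" "q = g t"
        using g by (auto simp: bij_betw_def)
      then obtain j where "e j = t"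
        using e n by (metis atLeastLessThan_iff bij_betw_def imageE le0 order.strict_trans2)
      then show "q \<in> range p"
        using t by (intro range_eqI[of _ _ j]) (simp add: p_def)
    qed
  qed
  moreover have "card (p -` {q}) \<le> (CARD('r) - 1) div card Q + 1" for q
  proof -
    \<comment> \<open>All indices in a fibre have the same remainder, so their quotients tell them
      apart.\<close>
    have "inj_on (\<lambda>j. e j div n) (p -` {q})"
    proof (rule inj_onI)
      fix i j assume *: "i \<in> p -` {q}" "j \<in> p -` {q}" "e i div n = e j div n"
      then have "g (e i mod n) = g (e j mod n)"
        by (simp add: p_def)
      then have "e i mod n = e j mod n"
        using g n by (auto simp: bij_betw_def inj_on_def)
      then have "e i = e j"
        using * by (metis div_mult_mod_eq)
      then show "i = j"
        using e by (auto simp: bij_betw_def inj_on_def)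
    qed
    moreover have "(\<lambda>j. e j div n) ` (p -` {q}) \<subseteq> {..(CARD('r) - 1) div n}"
    proof (rule image_subsetI)
      fix j
      show "e j div n \<in> {..(CARD('r) - 1) div n}"
        using e_lt[of j] by (simp add: div_le_mono)
    qed
    ultimately have "card (p -` {q}) \<le> card {..(CARD('r) - 1) div n}"
      by (rule card_inj_on_le) simp
    then show ?thesis
      by (simp add: n_def)
  qed
  ultimately show ?thesis
    using that by blast
qed

section \<open>The union over the hyperplanes and its completeness\<close>

text \<open>
  Points of \<open>PG(d - 1, 2)\<close> are encoded as nonempty subsets \<open>p\<close> of \<open>{..<d}\<close>, and so are the
  nonzero linear forms \<open>S\<close>; the value of \<open>S\<close> at \<open>p\<close> is the parity of \<open>card (S \<inter> p)\<close>.
\<close>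

definition hyperplane_coords :: "('r \<Rightarrow> nat set) \<Rightarrow> nat set \<Rightarrow> 'r set" where
  "hyperplane_coords p S = {j. even (card (S \<inter> p j))}"

definition hyperplane_union :: "nat \<Rightarrow> ('r \<Rightarrow> nat set) \<Rightarrow> (bit ^ 'r::finite) set" where
  "hyperplane_union d p = (\<Union>S \<in> Pow {..<d} - {{}}. supported_on (hyperplane_coords p S))"

lemma of_nat_bit_eq_1_iff: "(of_nat n :: bit) = 1 \<longleftrightarrow> odd n"
  by (simp only: Z2.bit_eq_iff[of _ 1] even_of_nat odd_one simp_thms)

text \<open>The masked vectors are the \<open>l f\<close> for the coordinate forms \<open>f\<close>.
  Summing those with \<open>c i = 1\<close> multiplies \<open>v $ j\<close> by the value at
  \<open>p j\<close> of the form \<open>{i. i < d \<and> c i = 1}\<close>.\<close>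

lemma sum_masked_nth:
  fixes v :: "bit ^ 'r::finite" and d :: nat
  shows "(\<Sum>i<d. c i *s (\<chi> j. if i \<in> p j then v $ j else 0)) $ j =
    of_nat (card ({i. i < d \<and> c i = 1} \<inter> p j)) * v $ j"
proof -
  have "(\<Sum>i<d. c i *s (\<chi> j. if i \<in> p j then v $ j else 0)) $ j =
      (\<Sum>i<d. (if i \<in> {i. i < d \<and> c i = 1} \<inter> p j then v $ j else 0))"
    unfolding sum_component by (intro sum.cong) auto
  also have "\<dots> = (\<Sum>i \<in> {..<d} \<inter> ({i. i < d \<and> c i = 1} \<inter> p j). v $ j)"
    by (rule sum.inter_restrict[symmetric]) simp
  also have "{..<d} \<inter> ({i. i < d \<and> c i = 1} \<inter> p j) = {i. i < d \<and> c i = 1} \<inter> p j"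
    by blast
  finally show ?thesis
    by simp
qed

lemma d_complete_hyperplane_union:
  fixes p :: "'r::finite \<Rightarrow> nat set"
  assumes big: "\<And>S. S \<subseteq> {..<d} \<Longrightarrow> S \<noteq> {} \<Longrightarrow> d \<le> card (hyperplane_coords p S)"
  shows "d_complete d (hyperplane_union d p)"
  unfolding d_complete_def
proof
  fix v :: "bit ^ 'r"
  show "\<exists>L. vec.subspace L \<and> vec.dim L = d \<and> (+) v ` (L - {0}) \<subseteq> hyperplane_union d p"
  proof (cases "v \<in> hyperplane_union d p")
    case True
    then obtain S where S: "S \<subseteq> {..<d}" "S \<noteq> {}" "v \<in> supported_on (hyperplane_coords p S)"
      by (auto simp: hyperplane_union_def)
    obtain L where L: "vec.subspace L" "vec.dim L = d" "L \<subseteq> supported_on (hyperplane_coords p S)"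
      using subspace_of_dim_supported_on big S by metis
    have "v + x \<in> hyperplane_union d p" if "x \<in> L" for x
      using S L that vec.subspace_add[OF subspace_supported_on, of v _ x]
      unfolding hyperplane_union_def by blast
    then show ?thesis
      using L by blast
  next
    case False
    define l where "l i = (\<chi> j. if i \<in> p j then v $ j else 0)" for i
    have sum_nth: "(\<Sum>i<d. c i *s l i) $ j =
        of_nat (card ({i. i < d \<and> c i = 1} \<inter> p j)) * v $ j" for c j
      unfolding l_def by (rule sum_masked_nth)
    have in_union: "v + (\<Sum>i<d. c i *s l i) \<in> hyperplane_union d p" if "i < d" "c i = 1" for c i
    proof -
      let ?S = "{i. i < d \<and> c i = 1}"
      \<comment> \<open>Where the form takes the value 1, \<open>v $ j\<close> is added to itself
        and vanishes in characteristic 2.\<close>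
      have "(v + (\<Sum>i<d. c i *s l i)) $ j = 0" if "odd (card (?S \<inter> p j))" for j
        using that of_nat_bit_eq_1_iff[of "card (?S \<inter> p j)"]
        by (simp only: vector_add_component sum_nth) simp
      then have "v + (\<Sum>i<d. c i *s l i) \<in> supported_on (hyperplane_coords p ?S)"
        unfolding supported_on_def hyperplane_coords_def by blast
      moreover have "?S \<in> Pow {..<d} - {{}}"
        using that by auto
      ultimately show ?thesis
        unfolding hyperplane_union_def by blast
    qed
    \<comment> \<open>A vanishing combination with some \<open>c i = 1\<close> would put
      \<open>v + 0\<close> into the union.\<close>
    have zero_coeffs: "c i = 0" if "(\<Sum>i<d. c i *s l i) = 0" "i < d" for c i
      using in_union[of i c] that False by (metis add.right_neutral bit_not_one_iff)
    \<comment> \<open>Independence of the image as a set does not exclude repetitions, but dimension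
      \<open>d\<close> requires \<open>d\<close> distinct vectors. A repetition would give the
      relation \<open>l a + l b = 0\<close>.\<close>
    have inj: "inj_on l {..<d}"
    proof (rule inj_onI, rule ccontr)
      fix a b assume *: "a \<in> {..<d}" "b \<in> {..<d}" "l a = l b" "a \<noteq> b"
      define c :: "nat \<Rightarrow> bit" where "c i = (if i = a \<or> i = b then 1 else 0)" for i
      have "(\<Sum>i<d. c i *s l i) = (\<Sum>i\<in>{a, b}. c i *s l i)"
        using * by (intro sum.mono_neutral_right) (auto simp: c_def)
      also have "\<dots> = 0"
        using * by (simp add: c_def vec_eq_iff)
      finally show False
        using zero_coeffs[of c a] * by (simp add: c_def)
    qed
    have reindex: "(\<Sum>x\<in>l ` {..<d}. u x *s x) = (\<Sum>i<d. u (l i) *s l i)" for u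
      using inj by (simp add: sum.reindex)
    have "vec.independent (l ` {..<d})"
      using zero_coeffs[of "\<lambda>i. u (l i)" for u]
      by (auto simp: vec.dependent_finite reindex)
    then have "vec.dim (vec.span (l ` {..<d})) = d"
      using inj by (simp add: vec.dim_eq_card_independent card_image)
    moreover have "v + x \<in> hyperplane_union d p" if x: "x \<in> vec.span (l ` {..<d})" "x \<noteq> 0" for x
    proof -
      obtain u where u: "x = (\<Sum>i<d. u (l i) *s l i)"
        using x(1) unfolding vec.span_finite[OF finite_imageI[OF finite_lessThan]] reindex by blast
      have "\<exists>i<d. u (l i) = 1"
      proof (rule ccontr)
        assume "\<not> ?thesis"
        then have "u (l i) = 0" if "i < d" for i
          using that bit_not_one_iff by blast
        then show False
          using x(2) u by simp
      qed
      then show ?thesis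
        using in_union[of _ "\<lambda>i. u (l i)"] u by blast
    qed
    ultimately show ?thesis
      using vec.subspace_span by blast
  qed
qed

section \<open>The size of the union\<close>

text \<open>Strictness comes from the zero vector, which all \<open>2 ^ d - 1 \<ge> 2\<close> parts
  share: it is removed from each part and counted once.\<close>

lemma card_hyperplane_union_less:
  fixes p :: "'r::finite \<Rightarrow> nat set"
  assumes "d \<ge> 2" and le: "\<And>S. S \<subseteq> {..<d} \<Longrightarrow> S \<noteq> {} \<Longrightarrow> card (hyperplane_coords p S) \<le> m"
  shows "card (hyperplane_union d p) < (2 ^ d - 1) * 2 ^ m"
proof -
  let ?F = "Pow {..<d} - {{}}"
  let ?D = "\<Union>S\<in>?F. supported_on (hyperplane_coords p S) - {0}"
  have card_F: "card ?F = 2 ^ d - 1"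
    by (simp add: card_Diff_singleton card_Pow)
  have zero: "0 \<in> supported_on J" for J :: "'r set"
    by (simp add: supported_on_def)
  have "card (supported_on (hyperplane_coords p S) - {0}) \<le> 2 ^ m - 1" if "S \<in> ?F" for S
  proof -
    have "card (supported_on (hyperplane_coords p S)) \<le> 2 ^ card (hyperplane_coords p S)"
      by (rule card_supported_on_le)
    also have "\<dots> \<le> 2 ^ m"
      using le that by (intro power_increasing) auto
    finally show ?thesis
      using zero by (simp add: card_Diff_singleton)
  qed
  then have "(\<Sum>S\<in>?F. card (supported_on (hyperplane_coords p S) - {0})) \<le> card ?F * (2 ^ m - 1)"
    using sum_bounded_above[of ?F "\<lambda>S. card (supported_on (hyperplane_coords p S) - {0})"]
    by simp
  moreover have "card ?D \<le> (\<Sum>S\<in>?F. card (supported_on (hyperplane_coords p S) - {0}))"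
    by (rule card_UN_le) simp
  moreover have "card (hyperplane_union d p) \<le> card (insert 0 ?D)"
    by (rule card_mono) (auto simp: hyperplane_union_def intro!: finite_supported_on)
  moreover have "card (insert 0 ?D) \<le> Suc (card ?D)"
    by (rule card_insert_le_m1) simp_all
  ultimately have "card (hyperplane_union d p) \<le> Suc (card ?F * (2 ^ m - 1))"
    by linarith
  moreover have "card ?F \<ge> 2"
  proof -
    have "(2::nat) ^ 2 \<le> 2 ^ d"
      using assms by (intro power_increasing) auto
    then show ?thesis
      by (simp add: card_F)
  qed
  moreover have "card ?F * 2 ^ m = card ?F * (2 ^ m - 1) + card ?F"
    by (simp add: diff_mult_distrib2)
  ultimately have "card (hyperplane_union d p) < card ?F * 2 ^ m"
    by linarith
  then show ?thesis
    by (simp add: card_F)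
qed

lemma le_two_power_pred: "d \<ge> 3 \<Longrightarrow> d \<le> 2 ^ (d - 1) - (1::nat)"
proof (induction d rule: dec_induct)
  case (step k)
  then have "(2::nat) ^ (Suc k - 1) = 2 * 2 ^ (k - 1)"
    by (cases k) auto
  then show ?case
    using step by linarith
qed simp

text \<open>\<open>k\<close> is the ceiling of \<open>CARD('r) / (2 ^ d - 1)\<close>. Every block
  has between 1 and \<open>k\<close> coordinates, and a hyperplane consists of
  \<open>2 ^ (d - 1) - 1\<close> blocks.\<close>

lemma gamma_less_blocks:
  fixes d :: nat
  assumes d: "d \<ge> 3" and r: "2 ^ d - 1 \<le> CARD('r::finite)"
  defines "k \<equiv> (CARD('r) - 1) div (2 ^ d - 1) + 1"
  shows "gamma TYPE('r) d < (2 ^ d - 1) * 2 ^ (k * (2 ^ (d - 1) - 1))"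
proof -
  let ?Q = "Pow {..<d} - {{}}"
  have card_Q: "card ?Q = 2 ^ d - 1"
    by (simp add: card_Diff_singleton card_Pow)
  have "{..<d} \<in> ?Q"
    using d by (auto simp: lessThan_empty_iff)
  then have "?Q \<noteq> {}"
    by blast
  then obtain p :: "'r \<Rightarrow> nat set" where p: "range p = ?Q" "\<And>q. card (p -` {q}) \<le> k"
    using even_distribution[of ?Q, where 'r = 'r] r unfolding card_Q k_def by auto
  have bounds: "2 ^ (d - 1) - 1 \<le> card (hyperplane_coords p S)"
    "card (hyperplane_coords p S) \<le> k * (2 ^ (d - 1) - 1)"
    if S: "S \<subseteq> {..<d}" "S \<noteq> {}" for S
  proof -
    let ?P = "{P \<in> ?Q. even (card (S \<inter> P))}"
    note card_P = card_nonempty_even_inter[OF S]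
    have P_eq: "?P = {P \<in> range p. even (card (S \<inter> P))}"
      by (simp only: p(1))
    \<comment> \<open>Since \<open>p\<close> is onto the points, each point of the hyperplane
      contributes at least one coordinate.\<close>
    then have "p ` hyperplane_coords p S = ?P"
      by (auto simp only: hyperplane_coords_def)
    then show "2 ^ (d - 1) - 1 \<le> card (hyperplane_coords p S)"
      using card_image_le[of "hyperplane_coords p S" p] card_P by simp
    have "hyperplane_coords p S = (\<Union>q\<in>?P. p -` {q})"
      unfolding P_eq hyperplane_coords_def by auto
    then have "card (hyperplane_coords p S) \<le> (\<Sum>q\<in>?P. card (p -` {q}))"
      by (simp only:) (rule card_UN_le, simp)
    also have "\<dots> \<le> card ?P * k"
      using sum_bounded_above[of ?P "\<lambda>q. card (p -` {q})" k] p(2) by simp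
    finally show "card (hyperplane_coords p S) \<le> k * (2 ^ (d - 1) - 1)"
      by (simp only: card_P mult.commute)
  qed
  have "d_complete d (hyperplane_union d p)"
    using bounds(1) le_two_power_pred[OF d] order_trans
    by (intro d_complete_hyperplane_union) blast
  then have "gamma TYPE('r) d \<le> card (hyperplane_union d p)"
    by (rule gamma_le)
  also have "\<dots> < (2 ^ d - 1) * 2 ^ (k * (2 ^ (d - 1) - 1))"
    using d bounds(2) by (intro card_hyperplane_union_less) auto
  finally show ?thesis .
qed

section \<open>The numerical bound\<close>

text \<open>Here \<open>eps d = 1 / (2 * n)\<close>, so the coefficient of \<open>r\<close> is
  \<open>(n - 1) / (2 * n)\<close> and the exponent in \<open>K d\<close> is
  \<open>(n - 1)\<^sup>2 / (2 * n)\<close>.\<close>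

lemma bound_eq:
  fixes d :: nat and r :: real
  assumes "d \<ge> 1"
  defines "n \<equiv> 2 ^ d - 1 :: real"
  shows "K d * 2 powr ((1 / 2 - eps d) * r) = n * 2 powr ((n - 1) * (r + n - 1) / (2 * n))"
proof -
  obtain e where e: "d = Suc e"
    using assms(1) by (cases d) auto
  have h: "2 ^ (d - 1) = (n + 1) / 2"
    by (simp add: n_def e)
  have "n > 0"
    using one_less_power[of "2::real" d] assms(1) by (simp add: n_def)
  then have "2 ^ (d - 1) - 3 / 2 + eps d + (1 / 2 - eps d) * r = (n - 1) * (r + n - 1) / (2 * n)"
    unfolding h eps_def n_def[symmetric] by (simp add: field_simps)
  then show ?thesis
    unfolding K_def by (simp add: n_def mult.assoc flip: powr_add)
qed

theorem theorem5:
  fixes r d :: nat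
  assumes "CARD('r::finite) = r" and "r \<ge> d" and "d \<ge> 3"
  shows "real (gamma TYPE('r) d) < K d * 2 powr ((1 / 2 - eps d) * real r)"
proof -
  define N where "N = (2::nat) ^ d - 1"
  define n where "n = (2::real) ^ d - 1"
  define b where "b = (n - 1) * (r + n - 1) / (2 * n)"
  have "(2::nat) ^ 3 \<le> 2 ^ d"
    using assms(3) by (intro power_increasing) auto
  then have N: "N \<ge> 7" "real N = n"
    by (auto simp: N_def n_def of_nat_diff)
  then have n: "n \<ge> 7"
    by linarith
  have bound: "K d * 2 powr ((1 / 2 - eps d) * real r) = n * 2 powr b"
    using assms(3) by (simp add: bound_eq n_def b_def)
  show ?thesis
  proof (cases "N \<le> r")
    case True
    define k where "k = (r - 1) div N + 1"
    have half: "real (2 ^ (d - 1) - 1) = (n - 1) / 2"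
      using assms(3) by (cases d) (simp_all add: n_def of_nat_diff)
    \<comment> \<open>Rounding \<open>r / N\<close> up to \<open>k\<close> costs at most
      \<open>N - 1\<close> in \<open>k * N\<close>; this accounts for \<open>r + n - 1\<close> in
      \<open>b\<close>.\<close>
    have "(r - 1) div N * N \<le> r - 1"
      by (rule div_times_less_eq_dividend)
    then have "k * N + 1 \<le> r + N"
      using True N unfolding k_def add_mult_distrib by linarith
    then have "real (k * N + 1) \<le> real (r + N)"
      by (rule of_nat_mono)
    then have "k * n \<le> r + n - 1"
      by (simp add: N)
    then have "(k * n) * ((n - 1) / (2 * n)) \<le> (r + n - 1) * ((n - 1) / (2 * n))"
      using n by (intro mult_right_mono) auto
    moreover have "(k * n) * ((n - 1) / (2 * n)) = k * ((n - 1) / 2)"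
      using n by simp
    ultimately have exponent: "k * ((n - 1) / 2) \<le> b"
      by (simp add: b_def mult.commute)
    have "gamma TYPE('r) d < N * 2 ^ (k * (2 ^ (d - 1) - 1))"
      using gamma_less_blocks[OF assms(3), where 'r = 'r] True
      by (simp add: assms(1) k_def N_def)
    then have "real (gamma TYPE('r) d) < real (N * 2 ^ (k * (2 ^ (d - 1) - 1)))"
      by (rule of_nat_less_iff[THEN iffD2])
    also have "\<dots> = n * 2 powr (real (k * (2 ^ (d - 1) - 1)))"
      by (subst powr_realpow) (simp_all add: N)
    also have "\<dots> \<le> n * 2 powr b"
      using exponent n unfolding of_nat_mult half by simp
    finally show ?thesis
      unfolding bound .
  next
    case False
    have "gamma TYPE('r) d \<le> CARD(bit ^ 'r)"
      using d_complete_UNIV[where 'r = 'r] assms(1,2) by (intro gamma_le) auto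
    also have "\<dots> \<le> 2 ^ r"
      using card_supported_on_le[of "UNIV :: 'r set"] by (simp add: assms(1) supported_on_def)
    finally have "real (gamma TYPE('r) d) \<le> real (2 ^ r)"
      by (rule of_nat_mono)
    also have "\<dots> = 2 powr r"
      by (simp add: powr_realpow)
    \<comment> \<open>The inequality \<open>r \<le> 2 + b\<close> amounts to
      \<open>r \<le> n + 1\<close>. The 2 costs a factor 4, which is less than
      \<open>n \<ge> 7\<close>.\<close>
    also have "\<dots> \<le> 2 powr (2 + b)"
    proof -
      have "real r \<le> n"
        using False N by linarith
      then have "(n + 1) * r \<le> (n + 1) * n"
        using n by (intro mult_left_mono) auto
      then have "r * (2 * n) \<le> 4 * n + (n - 1) * (r + n - 1)"
        using n by (simp add: algebra_simps)
      then have "real r \<le> 2 + b"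
        using n by (simp add: b_def field_simps)
      then show ?thesis
        by simp
    qed
    also have "\<dots> < n * 2 powr b"
      using n by (simp add: powr_add)
    finally show ?thesis
      unfolding bound .
  qed
qed

end
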